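(* Let $\mathbbm{k}$ be a field of any characteristic, let $(X,\triangleright)$ be a finite quandle and let $A=\mathbbm{k}[X]$ be its quandle algebra. Let $D$ be a derivation of $A$ and let $(c_i^j)_{i,j\in X}$ be the matrix representing $D$ in the basis $(e_x)_{x\in X}$, i.e. $D(e_x)=\sum_{z\in X}c_x^z e_z$. Then $$c_{x\triangleright y}^z=c_x^{\hat z}+\sum_{q\in x^{-1}(z)}c_y^q$$ for all $x,y,z\in X$, where $\hat z$ is the unique element of $X$ such that $\hat z\triangleright y=z$, and $x^{-1}(z)$ is the (possibly empty) set of elements $w\in X$ such that $x\triangleright w=z$.
   Context: A quandle is a set $X$ with a binary operation $\triangleright$ such that (I) $x\triangleright x=x$ for all $x$; (II) for all $y,z$ there is a unique $x$ with $x\triangleright y=z$; (III) $(x\triangleright y)\triangleright z=(x\triangleright z)\triangleright(y\triangleright z)$ for all $x,y,z$. For a field $\mathbbm{k}$, the quandle algebra $\mathbbm{k}[X]$ is the (generally nonassociative) $\mathbbm{k}$-algebra with basis $\{e_x\}_{x\in X}$ and bilinear product determined by $e_x\cdot e_y=e_{x\triangleright y}$. A derivation of an algebra $A$ is a linear map $D:A\to A$ with $D(a\cdot b)=D(a)\cdot b+a\cdot D(b)$ for all $a,b\in A$. *)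

theory Defs
  imports "HOL-Analysis.Cartesian_Space"
begin

locale quandle =
  fixes qop :: "'x \<Rightarrow> 'x \<Rightarrow> 'x"  (infixl "\<triangleright>" 70)
  assumes idem: "x \<triangleright> x = x"
    and right_div: "\<exists>!x. x \<triangleright> y = z"
    and right_distrib: "(x \<triangleright> y) \<triangleright> z = (x \<triangleright> z) \<triangleright> (y \<triangleright> z)"

text \<open>For a finite quandle on the type \<open>'x\<close>, the underlying space of the quandle algebra
  is \<open>'k ^ 'x\<close>.\<close>

definition qbasis :: "'x \<Rightarrow> 'k::field ^ 'x::finite" where
  "qbasis x = axis x 1"

text \<open>The bilinear extension of \<open>e(x) \<cdot> e(y) = e(x \<triangleright> y)\<close>.\<close>

definition qmult :: "('x \<Rightarrow> 'x \<Rightarrow> 'x) \<Rightarrow> 'k::field ^ 'x::finite \<Rightarrow> 'k ^ 'x \<Rightarrow> 'k ^ 'x" where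
  "qmult qop a b = (\<Sum>x\<in>UNIV. \<Sum>y\<in>UNIV. (a $ x * b $ y) *s qbasis (qop x y))"

lemma qmult_qbasis:
  fixes qop :: "'x::finite \<Rightarrow> 'x \<Rightarrow> 'x"
  shows "qmult qop (qbasis x :: 'k::field ^ 'x) (qbasis y) = qbasis (qop x y)"
proof -
  have "(\<Sum>v\<in>UNIV. ((qbasis x $ u :: 'k) * qbasis y $ v) *s qbasis (qop u v))
      = (if u = x then qbasis (qop x y) else 0)" for u
  proof -
    have "((qbasis x $ u :: 'k) * qbasis y $ v) *s qbasis (qop u v)
        = (if v = y then (if u = x then qbasis (qop x y) else 0) else 0)" for v
      by (auto simp: qbasis_def axis_def)
    then show ?thesis by simp
  qed
  then show ?thesis by (simp add: qmult_def)
qed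

definition derivation ::
    "('k::field ^ 'x::finite \<Rightarrow> 'k ^ 'x \<Rightarrow> 'k ^ 'x) \<Rightarrow> ('k ^ 'x \<Rightarrow> 'k ^ 'x) \<Rightarrow> bool" where
  "derivation mult D \<longleftrightarrow>
     Vector_Spaces.linear (*s) (*s) D \<and> (\<forall>a b. D (mult a b) = mult (D a) b + mult a (D b))"

end

theory Submission
  imports Defs
begin

text \<open>Write e_x for \<open>qbasis x\<close>. Apply \<open>D\<close> to e_x e_y = e_(x
  \<triangleright> y), expand by the Leibniz rule and compare coefficients at z. Right
  multiplication by e_y sums coefficients over the fibre of u \<mapsto> u \<triangleright> y above z
  (\<open>qmult_qbasis_right_nth\<close>), left multiplication by e_x over that of w \<mapsto> x
  \<triangleright> w (\<open>qmult_qbasis_left_nth\<close>). Right division makes the first fibre a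
  single point, so its sum is one matrix entry.\<close>

lemma qbasis_nth: "qbasis x $ z = (if z = x then 1 else 0)"
  by (simp add: qbasis_def axis_def)

lemma sum_qbasis_nth:
  fixes f :: "'x::finite \<Rightarrow> 'k::field"
  shows "(\<Sum>x\<in>UNIV. f x *s qbasis x) $ z = f z"
  by (simp add: qbasis_nth if_distrib cong: if_cong)

lemma qmult_nth:
  "qmult qop a b $ z = (\<Sum>x\<in>UNIV. \<Sum>y\<in>UNIV. if qop x y = z then a $ x * b $ y else 0)"
  unfolding qmult_def sum_component
  by (intro sum.cong refl) (simp add: qbasis_nth)

text \<open>The factor e_y kills every term whose second index is not y. For a general operation the
  remaining fibre can have any size, hence a sum.\<close>

lemma qmult_qbasis_right_nth:
  "qmult qop a (qbasis y) $ z = (\<Sum>w\<in>{w. qop w y = z}. a $ w)"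
proof -
  have "(if qop x v = z then a $ x * qbasis y $ v else 0)
      = (if v = y then if qop x y = z then a $ x else 0 else 0)" for x v
    by (simp add: qbasis_nth)
  then show ?thesis
    by (simp add: qmult_nth sum.If_cases)
qed

text \<open>Mirror image: e_x fixes the first index. Even in a quandle w \<mapsto> x
  \<triangleright> w need not be bijective, so this sum stays in the theorem.\<close>

lemma qmult_qbasis_left_nth:
  "qmult qop (qbasis x) b $ z = (\<Sum>w\<in>{w. qop x w = z}. b $ w)"
proof -
  have "(\<Sum>v\<in>UNIV. if qop u v = z then qbasis x $ u * b $ v else 0)
      = (if u = x then \<Sum>v\<in>UNIV. if qop x v = z then b $ v else 0 else 0)" for u
    by (cases "u = x") (simp_all add: qbasis_nth cong: if_cong)
  then show ?thesis
    by (simp add: qmult_nth sum.If_cases)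
qed

theorem proposition3p2:
  fixes qop :: "'x::finite \<Rightarrow> 'x \<Rightarrow> 'x"
    and D :: "'k::field ^ 'x \<Rightarrow> 'k ^ 'x"
    and c :: "'x \<Rightarrow> 'x \<Rightarrow> 'k"
  assumes "quandle qop"
    and "derivation (qmult qop) D"
    and "\<And>x. D (qbasis x) = (\<Sum>z\<in>UNIV. c x z *s qbasis z)"
  shows "c (qop x y) z = c x (THE w. qop w y = z) + (\<Sum>q\<in>{w. qop x w = z}. c y q)"
proof -
  have coeff: "D (qbasis u) $ v = c u v" for u v
    unfolding assms(3) by (rule sum_qbasis_nth)
  have "\<exists>!w. qop w y = z"
    using assms(1) by (rule quandle.right_div)
  \<comment> \<open>As an equivalence in u, unique solvability lets simp evaluate both the fibre and
    the \<open>THE\<close> term to the same \<open>w\<close>.\<close>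
  then obtain w where w: "qop u y = z \<longleftrightarrow> u = w" for u
    by blast
  then have fibre: "{u. qop u y = z} = {w}" and hat: "(THE u. qop u y = z) = w"
    by simp_all
  have "D (qbasis (qop x y)) = D (qmult qop (qbasis x) (qbasis y))"
    by (simp add: qmult_qbasis)
  also have "\<dots> = qmult qop (D (qbasis x)) (qbasis y) + qmult qop (qbasis x) (D (qbasis y))"
    using assms(2) by (simp add: derivation_def)
  finally have "D (qbasis (qop x y)) $ z
      = (qmult qop (D (qbasis x)) (qbasis y) + qmult qop (qbasis x) (D (qbasis y))) $ z"
    by simp
  then show ?thesis
    by (simp add: coeff qmult_qbasis_right_nth qmult_qbasis_left_nth fibre hat)
qed

end
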